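(* Let $d\ge1$ and let $c(i,j)$, $i,j\in\{1,\ldots,d\}$, be real numbers. Let $(\mathcal{A},\phi)$ be a probability space with expectation $\mathbb{E}$, with $\mathcal{A}$ generated by symmetric operators $X_1,\ldots,X_d$, such that for all $i,j\in\{1,\ldots,d\}$ \[ [a^-(i);a^+(j)]_0=c(i,j)\, I,\qquad [a^-(i);a^0(j)]_0=0,\qquad \mathbb{E}[X_i]=0, \] where $[A;B]_0=AB$ and $a^-(i),a^0(i),a^+(i)$ are the annihilation, preservation and creation operators of $X_i$. Then $(X_1,\ldots,X_d)$ is moment equal to a semicircular family of covariance $(c(i,j))_{i,j=1,\ldots,d}$.
   Context: **Probability spaces.** Let $(H,\langle\cdot,\cdot\rangle)$ be a real Hilbert space and $X_1,\ldots,X_d$ symmetric, densely defined linear operators on $H$. $\mathcal{A}$ is the unital algebra generated by $X_1,\ldots,X_d$ (containing the identity $I$). A unit vector $\phi\in H$ (the vacuum vector) lying in the domain of every $g\in\mathcal{A}$ is fixed. $(\mathcal{A},\phi)$ is called a probability space supported by $H$ and $\mathbb{E}[g]:=\langle g\phi,\phi\rangle$ for $g\in\mathcal{A}$. **Annihilation, preservation, creation operators.** For $n\ge 0$ let $F_n=\{p(X_1,\ldots,X_d)\phi: p \text{ a noncommutative polynomial of total degree}\le n\}$. Put $G_{-1}=\{0\}$, $G_0=F_0$, and for $n\ge1$ let $G_n$ be the orthogonal complement of $F_{n-1}$ in $F_n$. Then $\mathcal{A}\phi=\{g\phi:g\in\mathcal{A}\}$ is the algebraic direct sum of the $G_n$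 and $X_iG_n\subset G_{n-1}\oplus G_n\oplus G_{n+1}$; $a^-(i),a^0(i),a^+(i)$ are the unique linear operators with domain $\mathcal{A}\phi$ with $X_i=a^-(i)+a^0(i)+a^+(i)$ on $\mathcal{A}\phi$, $a^-(i)(G_n)\subset G_{n-1}$, $a^0(i)(G_n)\subset G_n$, $a^+(i)(G_n)\subset G_{n+1}$ for all $n\ge0$. Operator identities are on $\mathcal{A}\phi$. **Moment equality.** Two random vectors $(X_1,\ldots,X_d)$, $(Y_1,\ldots,Y_d)$ with respective expectations $\mathbb{E},\mathbb{E}'$ are moment equal if $\mathbb{E}[p(X_1,\ldots,X_d)]=\mathbb{E}'[p(Y_1,\ldots,Y_d)]$ for every polynomial $p$ in $d$ noncommutative variables. **Semicircular family.** A complete Feynman diagram $\gamma$ on $\{1,\ldots,2n\}$ is a partition of $\{1,\ldots,2n\}$ into two-element sets, regarded as a set of ordered pairs $(i,j)$ with $i<j$; it is noncrossing if there are no $(k,l),(i,j)\in\gamma$ with $k<i<l<j$. $\mathsf{NC}(\{1,\ldots,2n\})$ is the set of noncrossing ones. A semicircular family of covariance $(c(i,j))_{i,j=1,\ldots,d}$ is a family $(Y_1,\ldots,Y_d)$ of noncommutative random variables whose expectation $\mathbb{E}'$ satisfies, for all $k\in\mathbb{N}$ and $\sigma:\{1,\ldots,k\}\to\{1,\ldots,d\}$, \[ \mathbb{E}'[Y_{\sigma(1)}\cdots Y_{\sigma(k)}]=\sum_{\gamma\in\mathsf{NC}(\{1,\ldots,2n\})}\ \prod_{(i,j)\in\gamma}c(\sigma(i),\sigma(j))\quad\text{if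 }k=2n, \] and $\mathbb{E}'[Y_{\sigma(1)}\cdots Y_{\sigma(k)}]=0$ if $k$ is odd. *)

theory Defs
  imports
    "HOL-Analysis.Analysis"
    "HOL-Library.Poly_Mapping"
    "HOL-Library.Disjoint_Sets"
    "HOL-Library.FuncSet"
begin

(* An unbounded operator on H is a partial function H \<rightharpoonup> H.  Sums and scalar multiples carry
   their natural domains; composition is map_comp, whose domain is
   {x \<in> dom S. S x \<in> dom T} for T \<circ>\<^sub>m S. *)

definition op_linear :: "('h::real_vector \<rightharpoonup> 'h) \<Rightarrow> bool" where
  "op_linear T \<longleftrightarrow> subspace (dom T) \<and>
     (\<forall>x\<in>dom T. \<forall>y\<in>dom T. the (T (x + y)) = the (T x) + the (T y)) \<and>
     (\<forall>r. \<forall>x\<in>dom T. the (T (r *\<^sub>R x)) = r *\<^sub>R the (T x))"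

definition op_densely_defined :: "('h::topological_space \<rightharpoonup> 'h) \<Rightarrow> bool" where
  "op_densely_defined T \<longleftrightarrow> closure (dom T) = UNIV"

definition op_symmetric :: "('h::real_inner \<rightharpoonup> 'h) \<Rightarrow> bool" where
  "op_symmetric T \<longleftrightarrow>
     (\<forall>x\<in>dom T. \<forall>y\<in>dom T. inner (the (T x)) y = inner x (the (T y)))"

definition op_scale :: "real \<Rightarrow> ('h::real_vector \<rightharpoonup> 'h) \<Rightarrow> ('h \<rightharpoonup> 'h)" where
  "op_scale r T = (\<lambda>x. if x \<in> dom T then Some (r *\<^sub>R the (T x)) else None)"

definition op_add :: "('h::real_vector \<rightharpoonup> 'h) \<Rightarrow> ('h \<rightharpoonup> 'h) \<Rightarrow> ('h \<rightharpoonup> 'h)" where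
  "op_add S T = (\<lambda>x. if x \<in> dom S \<inter> dom T then Some (the (S x) + the (T x)) else None)"

(* The unital algebra generated by X 1, ..., X d; the identity I is Some. *)
inductive_set op_algebra :: "nat \<Rightarrow> (nat \<Rightarrow> ('h::real_vector \<rightharpoonup> 'h)) \<Rightarrow> ('h \<rightharpoonup> 'h) set"
  for d :: nat and X :: "nat \<Rightarrow> ('h \<rightharpoonup> 'h)" where
  one: "Some \<in> op_algebra d X"
| gen: "i \<in> {1..d} \<Longrightarrow> X i \<in> op_algebra d X"
| scale: "T \<in> op_algebra d X \<Longrightarrow> op_scale r T \<in> op_algebra d X"
| add: "S \<in> op_algebra d X \<Longrightarrow> T \<in> op_algebra d X \<Longrightarrow> op_add S T \<in> op_algebra d X"
| comp: "S \<in> op_algebra d X \<Longrightarrow> T \<in> op_algebra d X \<Longrightarrow> S \<circ>\<^sub>m T \<in> op_algebra d X"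

definition nc_prob_space ::
  "nat \<Rightarrow> (nat \<Rightarrow> ('h::{real_inner, complete_space} \<rightharpoonup> 'h)) \<Rightarrow> 'h \<Rightarrow> bool" where
  "nc_prob_space d X \<phi> \<longleftrightarrow>
     (\<forall>i\<in>{1..d}. op_linear (X i) \<and> op_densely_defined (X i) \<and> op_symmetric (X i)) \<and>
     norm \<phi> = 1 \<and> (\<forall>g\<in>op_algebra d X. \<phi> \<in> dom g)"

definition nc_expect :: "'h::real_inner \<Rightarrow> ('h \<rightharpoonup> 'h) \<Rightarrow> real" where
  "nc_expect \<phi> g = inner (the (g \<phi>)) \<phi>"

(* The monomial X (w!0) X (w!1) ...: the last letter acts first. *)
definition op_word :: "(nat \<Rightarrow> ('h \<rightharpoonup> 'h)) \<Rightarrow> nat list \<Rightarrow> ('h \<rightharpoonup> 'h)" where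
  "op_word X w = foldr (\<lambda>i T. X i \<circ>\<^sub>m T) w Some"

(* A polynomial in d noncommuting variables is a finitely supported real function on the
   words over {1..d}. *)
definition ncpolys :: "nat \<Rightarrow> (nat list \<Rightarrow>\<^sub>0 real) set" where
  "ncpolys d = {p. \<forall>w\<in>Poly_Mapping.keys p. set w \<subseteq> {1..d}}"

definition op_poly ::
  "(nat \<Rightarrow> ('h::real_vector \<rightharpoonup> 'h)) \<Rightarrow> (nat list \<Rightarrow>\<^sub>0 real) \<Rightarrow> ('h \<rightharpoonup> 'h)" where
  "op_poly X p = (\<lambda>x. if \<forall>w\<in>Poly_Mapping.keys p. x \<in> dom (op_word X w)
     then Some (\<Sum>w\<in>Poly_Mapping.keys p. Poly_Mapping.lookup p w *\<^sub>R the (op_word X w x))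
     else None)"

definition vacuum_orbit :: "nat \<Rightarrow> (nat \<Rightarrow> ('h::real_vector \<rightharpoonup> 'h)) \<Rightarrow> 'h \<Rightarrow> 'h set" where
  "vacuum_orbit d X \<phi> = {the (g \<phi>) | g. g \<in> op_algebra d X}"

definition filt_space ::
  "nat \<Rightarrow> (nat \<Rightarrow> ('h::real_vector \<rightharpoonup> 'h)) \<Rightarrow> 'h \<Rightarrow> nat \<Rightarrow> 'h set" where
  "filt_space d X \<phi> n = {the (op_poly X p \<phi>) | p.
     p \<in> ncpolys d \<and> (\<forall>w\<in>Poly_Mapping.keys p. length w \<le> n)}"

(* Integer index, so that the space with index -1 is {0}. *)
definition grade_space ::
  "nat \<Rightarrow> (nat \<Rightarrow> ('h::real_inner \<rightharpoonup> 'h)) \<Rightarrow> 'h \<Rightarrow> int \<Rightarrow> 'h set" where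
  "grade_space d X \<phi> n =
     (if n < 0 then {0}
      else if n = 0 then filt_space d X \<phi> 0
      else {v \<in> filt_space d X \<phi> (nat n). \<forall>u\<in>filt_space d X \<phi> (nat (n - 1)). orthogonal u v})"

(* am, a0, ap are the annihilation, preservation and creation operators of X i.  In a
   probability space these conditions determine the three partial functions uniquely. *)
definition cap_operators ::
  "nat \<Rightarrow> (nat \<Rightarrow> ('h::real_inner \<rightharpoonup> 'h)) \<Rightarrow> 'h \<Rightarrow> nat \<Rightarrow>
     ('h \<rightharpoonup> 'h) \<Rightarrow> ('h \<rightharpoonup> 'h) \<Rightarrow> ('h \<rightharpoonup> 'h) \<Rightarrow> bool" where
  "cap_operators d X \<phi> i am a0 ap \<longleftrightarrow>
     (\<forall>a\<in>{am, a0, ap}. op_linear a \<and> dom a = vacuum_orbit d X \<phi>) \<and>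
     (\<forall>v\<in>vacuum_orbit d X \<phi>. X i v = op_add (op_add am a0) ap v) \<and>
     (\<forall>n::nat. \<forall>v\<in>grade_space d X \<phi> (int n).
        the (am v) \<in> grade_space d X \<phi> (int n - 1) \<and>
        the (a0 v) \<in> grade_space d X \<phi> (int n) \<and>
        the (ap v) \<in> grade_space d X \<phi> (int n + 1))"

definition moment_equal ::
  "nat \<Rightarrow> (nat \<Rightarrow> ('h::real_inner \<rightharpoonup> 'h)) \<Rightarrow> 'h \<Rightarrow>
     (nat \<Rightarrow> ('k::real_inner \<rightharpoonup> 'k)) \<Rightarrow> 'k \<Rightarrow> bool" where
  "moment_equal d X \<phi> Y \<psi> \<longleftrightarrow>
     (\<forall>p\<in>ncpolys d. nc_expect \<phi> (op_poly X p) = nc_expect \<psi> (op_poly Y p))"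

definition feynman_diagrams :: "nat \<Rightarrow> (nat \<times> nat) set set" where
  "feynman_diagrams m = {\<gamma>. (\<forall>(i, j)\<in>\<gamma>. i < j) \<and> partition_on {1..m} ((\<lambda>(i, j). {i, j}) ` \<gamma>)}"

definition noncrossing :: "(nat \<times> nat) set \<Rightarrow> bool" where
  "noncrossing \<gamma> \<longleftrightarrow> \<not> (\<exists>k l i j. (k, l) \<in> \<gamma> \<and> (i, j) \<in> \<gamma> \<and> k < i \<and> i < l \<and> l < j)"

definition NC_diagrams :: "nat \<Rightarrow> (nat \<times> nat) set set" where
  "NC_diagrams m = {\<gamma> \<in> feynman_diagrams m. noncrossing \<gamma>}"

definition semicircular_family ::
  "nat \<Rightarrow> (nat \<Rightarrow> nat \<Rightarrow> real) \<Rightarrow>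
     (nat \<Rightarrow> ('k::{real_inner, complete_space} \<rightharpoonup> 'k)) \<Rightarrow> 'k \<Rightarrow> bool" where
  "semicircular_family d c Y \<psi> \<longleftrightarrow> nc_prob_space d Y \<psi> \<and>
     (\<forall>k. \<forall>\<sigma>\<in>{1..k} \<rightarrow> {1..d}.
        (\<forall>n. k = 2 * n \<longrightarrow>
           nc_expect \<psi> (op_word Y (map \<sigma> [1..<k + 1])) =
             (\<Sum>\<gamma>\<in>NC_diagrams (2 * n). \<Prod>(i, j)\<in>\<gamma>. c (\<sigma> i) (\<sigma> j))) \<and>
        (odd k \<longrightarrow> nc_expect \<psi> (op_word Y (map \<sigma> [1..<k + 1])) = 0))"

end

theory Submission
  imports Defs
begin

text \<open>
  Both sides of the moment formula obey one and the same recursion, which reads the word from left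
  to right and keeps a stack.

  On the combinatorial side the stack holds the points that have been read and still wait for a
  partner. A new point either joins the stack or is paired with a waiting point; in a noncrossing
  pairing this can only be the most recent one, since an arc to any other would cross the arc
  that starts at the top of the stack.

  On the operator side the stack \<open>i\<^sub>1, i\<^sub>2, \<dots>, i\<^sub>k\<close> (top first) stands for the operator
  \<open>a\<^sup>-(i\<^sub>k) \<dots> a\<^sup>-(i\<^sub>2) a\<^sup>-(i\<^sub>1)\<close> in front of the unread letters. Expanding the next letter as
  \<open>X\<^sub>j = a\<^sup>-(j) + a\<^sup>0(j) + a\<^sup>+(j)\<close>, the first summand pushes \<open>j\<close>, the second contributes nothing because
  \<open>a\<^sup>-(i) a\<^sup>0(j) = 0\<close>, and the third pops the top \<open>i\<close> with the factor \<open>c i j\<close>. With an empty stack only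
  the first summand survives: a created vector and a preserved vector are both orthogonal to the
  vacuum. For created vectors this is the orthogonality of the grades; for preserved vectors the
  degree 0 part needs in addition that the \<open>X\<^sub>j\<close> are centred. When all letters are read, an
  annihilator meeting the vacuum gives 0, so only the empty stack contributes.

  The two sides of this argument are \<open>sum_open_pairings\<close> and \<open>inner_annihilate_word\<close>. Together they
  show that the given operators form a semicircular family themselves, and any two semicircular
  families of the same covariance have equal word moments, hence by linearity equal moments.
\<close>

section \<open>Noncrossing pairings read from left to right\<close>

text \<open>
  The weighted count of the ways to complete a noncrossing pairing when the points in the first list
  (most recent first) are still unpaired and those in the second are yet to be read.
\<close>

fun stack_moment :: "('b \<Rightarrow> 'b \<Rightarrow> real) \<Rightarrow> 'b list \<Rightarrow> 'b list \<Rightarrow> real" where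
  "stack_moment c s [] = (if s = [] then 1 else 0)"
| "stack_moment c [] (j # w) = stack_moment c [j] w"
| "stack_moment c (i # s) (j # w) = stack_moment c (j # i # s) w + c i j * stack_moment c s w"

lemma stack_moment_map:
  "stack_moment c (map \<sigma> s) (map \<sigma> w) = stack_moment (\<lambda>i j. c (\<sigma> i) (\<sigma> j)) s w"
proof (induction w arbitrary: s)
  case (Cons j w)
  have "stack_moment c (map \<sigma> (j # s)) (map \<sigma> w) = stack_moment (\<lambda>i j. c (\<sigma> i) (\<sigma> j)) (j # s) w"
    by (rule Cons.IH)
  then show ?case using Cons.IH by (cases s) simp_all
qed simp

lemma stack_moment_odd:
  "odd (length s + length w) \<Longrightarrow> stack_moment c s w = 0"
  by (induction c s w rule: stack_moment.induct) auto

text \<open>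
  States of the left-to-right reading: \<open>S\<close> are the waiting points and \<open>T\<close> the unread ones. Requiring
  that every arc ends in \<open>T\<close> keeps two waiting points from being paired with each other.
\<close>

definition open_pairings :: "nat set \<Rightarrow> nat set \<Rightarrow> (nat \<times> nat) set set" where
  "open_pairings S T = {\<gamma>. (\<forall>(i, j)\<in>\<gamma>. i < j \<and> i \<in> S \<union> T \<and> j \<in> T) \<and>
     (\<forall>v\<in>S \<union> T. \<exists>!e. e \<in> \<gamma> \<and> (v = fst e \<or> v = snd e)) \<and> noncrossing \<gamma>}"

lemma open_pairingsD:
  assumes "\<gamma> \<in> open_pairings S T"
  shows "(i, j) \<in> \<gamma> \<Longrightarrow> i < j \<and> i \<in> S \<union> T \<and> j \<in> T"
    and "v \<in> S \<union> T \<Longrightarrow> \<exists>!e. e \<in> \<gamma> \<and> (v = fst e \<or> v = snd e)"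
    and "noncrossing \<gamma>"
proof -
  have *: "\<forall>(i, j)\<in>\<gamma>. i < j \<and> i \<in> S \<union> T \<and> j \<in> T"
      "\<forall>v\<in>S \<union> T. \<exists>!e. e \<in> \<gamma> \<and> (v = fst e \<or> v = snd e)" "noncrossing \<gamma>"
    using assms[unfolded open_pairings_def mem_Collect_eq] by simp_all
  show "(i, j) \<in> \<gamma> \<Longrightarrow> i < j \<and> i \<in> S \<union> T \<and> j \<in> T" using *(1) by blast
  show "v \<in> S \<union> T \<Longrightarrow> \<exists>!e. e \<in> \<gamma> \<and> (v = fst e \<or> v = snd e)" by (rule bspec[OF *(2)])
  show "noncrossing \<gamma>" by (rule *(3))
qed

text \<open>
  For strictly increasing pairs, \<open>(i, j) \<mapsto> {i, j}\<close> is injective, so being a partition into blocks says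
  that every point is an end of exactly one arc. In this form a pairing can be changed arc by arc.
\<close>

lemma partition_on_pairs_iff:
  assumes "\<And>i j. (i, j) \<in> \<gamma> \<Longrightarrow> i < (j::nat)"
  shows "partition_on V ((\<lambda>(i, j). {i, j}) ` \<gamma>) \<longleftrightarrow>
    (\<forall>(i, j)\<in>\<gamma>. i \<in> V \<and> j \<in> V) \<and> (\<forall>v\<in>V. \<exists>!e. e \<in> \<gamma> \<and> (v = fst e \<or> v = snd e))"
    (is "?P \<longleftrightarrow> ?Q")
proof -
  have block: "{fst e, snd e} \<in> (\<lambda>(i, j). {i, j}) ` \<gamma>" if "e \<in> \<gamma>" for e
    using that by (intro image_eqI[of _ _ e]) (simp_all add: case_prod_unfold)
  show ?thesis
  proof
    assume P: ?P
    then have un: "\<Union> ((\<lambda>(i, j). {i, j}) ` \<gamma>) = V" and dj: "disjoint ((\<lambda>(i, j). {i, j}) ` \<gamma>)"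
      by (auto simp: partition_on_def)
    have "\<exists>!e. e \<in> \<gamma> \<and> (v = fst e \<or> v = snd e)" if "v \<in> V" for v
    proof -
      from that un obtain e where e: "e \<in> \<gamma>" "v = fst e \<or> v = snd e" by auto
      moreover have "e' = e" if e': "e' \<in> \<gamma>" "v = fst e' \<or> v = snd e'" for e'
      proof -
        have "{fst e, snd e} = {fst e', snd e'}"
          using disjointD[OF dj block[OF e(1)] block[OF e'(1)]] e(2) e'(2) by blast
        moreover have "fst e < snd e" "fst e' < snd e'"
          using assms[of "fst e" "snd e"] assms[of "fst e'" "snd e'"] e(1) e'(1) by auto
        ultimately show ?thesis by (auto simp: doubleton_eq_iff prod_eq_iff)
      qed
      ultimately show ?thesis by blast
    qed
    moreover have "\<forall>(i, j)\<in>\<gamma>. i \<in> V \<and> j \<in> V" using un by auto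
    ultimately show ?Q by blast
  next
    assume Q: ?Q
    have ends: "fst e \<in> V" "snd e \<in> V" if "e \<in> \<gamma>" for e
      using conjunct1[OF Q] that by (auto simp: case_prod_unfold)
    note ex1 = bspec[OF conjunct2[OF Q]]
    show ?P
    proof (rule partition_onI)
      show "\<Union> ((\<lambda>(i, j). {i, j}) ` \<gamma>) = V"
      proof
        show "V \<subseteq> \<Union> ((\<lambda>(i, j). {i, j}) ` \<gamma>)"
        proof
          fix v assume "v \<in> V"
          then obtain e where e: "e \<in> \<gamma>" "v = fst e \<or> v = snd e" using ex1 by blast
          then have "v \<in> {fst e, snd e}" by blast
          with block[OF e(1)] show "v \<in> \<Union> ((\<lambda>(i, j). {i, j}) ` \<gamma>)" by (rule UnionI)
        qed
      qed (use ends in force)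
    next
      fix p q assume "p \<in> (\<lambda>(i, j). {i, j}) ` \<gamma>" "q \<in> (\<lambda>(i, j). {i, j}) ` \<gamma>" "p \<noteq> q"
      then obtain e e' where e: "e \<in> \<gamma>" "e' \<in> \<gamma>" "p = {fst e, snd e}" "q = {fst e', snd e'}"
        by (auto simp: case_prod_unfold)
      have "v \<notin> q" if "v \<in> p" for v
      proof
        assume "v \<in> q"
        have "v \<in> V" using ends e that by blast
        from ex1[OF this] have "e = e'" using e \<open>v \<in> p\<close> \<open>v \<in> q\<close> by blast
        with e \<open>p \<noteq> q\<close> show False by simp
      qed
      then show "disjnt p q" by (auto simp: disjnt_def)
    next
      show "{} \<notin> (\<lambda>(i, j). {i, j}) ` \<gamma>" by auto
    qed
  qed
qed

lemma NC_diagrams_eq_open_pairings: "NC_diagrams m = open_pairings {} {1..m}"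
proof -
  have "\<gamma> \<in> feynman_diagrams m \<longleftrightarrow> (\<forall>(i, j)\<in>\<gamma>. i < j \<and> i \<in> {1..m} \<and> j \<in> {1..m}) \<and>
     (\<forall>v\<in>{1..m}. \<exists>!e. e \<in> \<gamma> \<and> (v = fst e \<or> v = snd e))" for \<gamma>
  proof (cases "\<forall>(i, j)\<in>\<gamma>. i < j")
    case True
    then have "\<And>i j. (i, j) \<in> \<gamma> \<Longrightarrow> i < j" by blast
    from partition_on_pairs_iff[where V = "{1..m}", OF this] show ?thesis
      using True by (simp add: feynman_diagrams_def case_prod_unfold ball_conj_distrib)
  next
    case False
    then show ?thesis unfolding feynman_diagrams_def by blast
  qed
  then show ?thesis unfolding NC_diagrams_def open_pairings_def by simp
qed

lemma finite_open_pairings: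
  assumes "finite S" "finite T"
  shows "finite (open_pairings S T)" and "\<gamma> \<in> open_pairings S T \<Longrightarrow> finite \<gamma>"
proof -
  have sub: "open_pairings S T \<subseteq> Pow ((S \<union> T) \<times> T)"
    using open_pairingsD(1) by fast
  then show "finite (open_pairings S T)"
    using assms by (meson finite_Pow_iff finite_SigmaI finite_UnI finite_subset)
  show "finite \<gamma>" if "\<gamma> \<in> open_pairings S T"
    using sub that assms by (meson PowD finite_SigmaI finite_UnI finite_subset subsetD)
qed

lemma open_pairings_no_letters:
  "open_pairings S {} = (if S = {} then {{}} else {})"
  by (auto simp: open_pairings_def noncrossing_def)

text \<open>
  Moving a point from the unread to the waiting ones only takes away its right to end an arc.
\<close>

lemma open_pairings_push:
  assumes "p \<notin> T"
  shows "open_pairings (insert p S) T = {\<gamma> \<in> open_pairings S (insert p T). p \<notin> snd ` \<gamma>}"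
proof -
  have union: "insert p S \<union> T = S \<union> insert p T" by blast
  have closers: "(\<forall>(i, j)\<in>\<gamma>. i < j \<and> i \<in> U \<and> j \<in> T) \<longleftrightarrow>
    (\<forall>(i, j)\<in>\<gamma>. i < j \<and> i \<in> U \<and> j \<in> insert p T) \<and> p \<notin> snd ` \<gamma>" for U :: "nat set" and \<gamma>
    using assms by force
  show ?thesis
    unfolding set_eq_iff open_pairings_def mem_Collect_eq union closers
    by (intro allI) (simp only: conj_ac)
qed

text \<open>
  The first unread point cannot end an arc when nothing is waiting, so it has to be pushed.
\<close>

lemma open_pairings_empty_stack:
  assumes "\<And>t. t \<in> T \<Longrightarrow> p < t"
  shows "open_pairings {} (insert p T) = open_pairings {p} T"
proof -
  have "p \<notin> T" using assms by blast
  moreover have "p \<notin> snd ` \<gamma>" if "\<gamma> \<in> open_pairings {} (insert p T)" for \<gamma>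
  proof
    assume "p \<in> snd ` \<gamma>"
    then obtain i where "(i, p) \<in> \<gamma>" by force
    from open_pairingsD(1)[OF that this] show False using assms by (auto dest: less_asym)
  qed
  ultimately show ?thesis by (subst open_pairings_push) auto
qed

text \<open>
  The step that uses the noncrossing condition: an arc that ends at the first unread point \<open>p\<close> has to
  start at the most recent waiting point \<open>i\<close>, and then \<open>i\<close> and \<open>p\<close> are adjacent among all remaining
  points, so the arc puts no constraint on the others.
\<close>

lemma open_pairings_pop:
  assumes i: "\<And>s. s \<in> S \<Longrightarrow> s < i" and "i < p" and p: "\<And>t. t \<in> T \<Longrightarrow> p < t"
  shows "{\<gamma> \<in> open_pairings (insert i S) (insert p T). p \<in> snd ` \<gamma>} =
    insert (i, p) ` open_pairings S T" (is "?L = ?R")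
proof
  have notin: "i \<notin> S" "p \<notin> S" "i \<notin> T" "p \<notin> T" "i \<noteq> p"
    using i[of i] i[of p] p[of p] p[of i] \<open>i < p\<close> by auto
  show "?L \<subseteq> ?R"
  proof
    fix \<gamma> assume \<gamma>: "\<gamma> \<in> ?L"
    then have "\<gamma> \<in> open_pairings (insert i S) (insert p T)" by blast
    note ends = open_pairingsD(1)[OF this] and ex1 = open_pairingsD(2)[OF this]
      and nc = open_pairingsD(3)[OF this]
    have uniq: "e = e'" if "e \<in> \<gamma>" "e' \<in> \<gamma>" "v \<in> {fst e, snd e}" "v \<in> {fst e', snd e'}" for e e' v
    proof -
      have "v \<in> insert i S \<union> insert p T"
        using ends[of "fst e" "snd e"] that by auto
      from ex1[OF this] that show ?thesis by blast
    qed
    from \<gamma> obtain k where k: "(k, p) \<in> \<gamma>" by force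
    have "k \<in> insert i S" using ends[OF k] p by (auto dest: less_asym)
    have "k = i"
    proof (rule ccontr)
      assume "k \<noteq> i"
      then have "k < i" using i \<open>k \<in> insert i S\<close> by blast
      obtain e where e: "e \<in> \<gamma>" "i = fst e \<or> i = snd e" using ex1[of i] by blast
      have "snd e \<noteq> i" using ends[of "fst e" "snd e"] e notin by auto
      then have il: "(i, snd e) \<in> \<gamma>" using e by (metis prod.collapse)
      have "snd e \<noteq> p" using uniq[OF il k, of p] \<open>k \<noteq> i\<close> by auto
      then have "p < snd e" using ends[OF il] p by blast
      \<comment> \<open>The top \<open>i\<close> of the stack would be closed after \<open>p\<close>, so its arc would cross \<open>(k, p)\<close>.\<close>
      then show False using nc il k \<open>k < i\<close> \<open>i < p\<close> unfolding noncrossing_def by blast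
    qed
    then have ip: "(i, p) \<in> \<gamma>" using k by simp
    define \<delta> where "\<delta> = \<gamma> - {(i, p)}"
    have d: "a \<notin> {i, p} \<and> b \<notin> {i, p}" if "(a, b) \<in> \<delta>" for a b
    proof -
      have ab: "(a, b) \<in> \<gamma>" "(i, p) \<noteq> (a, b)" using that unfolding \<delta>_def by blast+
      have "v \<notin> {a, b}" if "v \<in> {i, p}" for v
        using uniq[OF ip ab(1), of v] ab(2) that by (metis fst_conv snd_conv)
      then show ?thesis by blast
    qed
    have "\<delta> \<in> open_pairings S T"
      unfolding open_pairings_def mem_Collect_eq
    proof (intro conjI ballI)
      fix e assume "e \<in> \<delta>"
      then show "case e of (a, b) \<Rightarrow> a < b \<and> a \<in> S \<union> T \<and> b \<in> T"
        using d[of "fst e" "snd e"] ends[of "fst e" "snd e"] by (auto simp: \<delta>_def)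
    next
      fix v assume v: "v \<in> S \<union> T"
      then have "v \<noteq> i" "v \<noteq> p" using notin by auto
      then have "e \<in> \<delta> \<and> (v = fst e \<or> v = snd e) \<longleftrightarrow> e \<in> \<gamma> \<and> (v = fst e \<or> v = snd e)" for e
        by (auto simp: \<delta>_def)
      then show "\<exists>!e. e \<in> \<delta> \<and> (v = fst e \<or> v = snd e)" using ex1[of v] v by simp
    next
      show "noncrossing \<delta>" using nc unfolding noncrossing_def \<delta>_def by blast
    qed
    moreover have "\<gamma> = insert (i, p) \<delta>" using ip by (auto simp: \<delta>_def)
    ultimately show "\<gamma> \<in> ?R" by blast
  qed
  show "?R \<subseteq> ?L"
  proof
    fix \<gamma> assume "\<gamma> \<in> ?R"
    then obtain \<delta> where \<gamma>: "\<gamma> = insert (i, p) \<delta>" and \<delta>: "\<delta> \<in> open_pairings S T" by blast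
    note ends = open_pairingsD(1)[OF \<delta>] and ex1 = open_pairingsD(2)[OF \<delta>]
      and nc = open_pairingsD(3)[OF \<delta>]
    have "\<gamma> \<in> open_pairings (insert i S) (insert p T)"
      unfolding open_pairings_def mem_Collect_eq
    proof (intro conjI ballI)
      fix e assume "e \<in> \<gamma>"
      then show "case e of (a, b) \<Rightarrow> a < b \<and> a \<in> insert i S \<union> insert p T \<and> b \<in> insert p T"
        using ends[of "fst e" "snd e"] \<open>i < p\<close> by (auto simp: \<gamma>)
    next
      fix v assume v: "v \<in> insert i S \<union> insert p T"
      show "\<exists>!e. e \<in> \<gamma> \<and> (v = fst e \<or> v = snd e)"
      proof (cases "v \<in> {i, p}")
        case True
        have "\<not> (e \<in> \<delta> \<and> (v = fst e \<or> v = snd e))" for e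
          using ends[of "fst e" "snd e"] True notin by auto
        then have "e \<in> \<gamma> \<and> (v = fst e \<or> v = snd e) \<longleftrightarrow> e = (i, p)" for e
          using True unfolding \<gamma> by fastforce
        then show ?thesis by simp
      next
        case False
        then have "e \<in> \<gamma> \<and> (v = fst e \<or> v = snd e) \<longleftrightarrow> e \<in> \<delta> \<and> (v = fst e \<or> v = snd e)" for e
          by (auto simp: \<gamma>)
        then show ?thesis using ex1[of v] v False by simp
      qed
    next
      \<comment> \<open>No remaining point lies between \<open>i\<close> and \<open>p\<close>, so the new arc crosses nothing.\<close>
      have gap: "\<not> (i < a \<and> a < p)" if "a \<in> S \<union> T" for a
        using that i p by (auto dest: less_asym)
      show "noncrossing \<gamma>"
        unfolding noncrossing_def
      proof
        assume "\<exists>k l a b. (k, l) \<in> \<gamma> \<and> (a, b) \<in> \<gamma> \<and> k < a \<and> a < l \<and> l < b"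
        then obtain k l a b where *: "(k, l) \<in> \<gamma>" "(a, b) \<in> \<gamma>" "k < a" "a < l" "l < b" by blast
        show False
        proof (cases "(k, l) = (i, p) \<or> (a, b) = (i, p)")
          case True
          then show False using * ends[of a b] ends[of k l] gap[of a] gap[of l] by (auto simp: \<gamma>)
        next
          case False
          then show False using * nc unfolding \<gamma> noncrossing_def by blast
        qed
      qed
    qed
    then show "\<gamma> \<in> ?L" by (force simp: \<gamma>)
  qed
qed

text \<open>
  Sorting the pairings by whether the next point \<open>p\<close> ends an arc gives the two summands of the stack
  recursion. The head of \<open>s\<close> has to be the largest waiting point, so \<open>s\<close> is decreasing.
\<close>

lemma sum_open_pairings:
  fixes b :: "nat \<Rightarrow> nat \<Rightarrow> real"
  assumes "sorted_wrt (>) s" "sorted_wrt (<) w" "\<And>x y. x \<in> set s \<Longrightarrow> y \<in> set w \<Longrightarrow> x < y"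
  shows "(\<Sum>\<gamma>\<in>open_pairings (set s) (set w). \<Prod>(i, j)\<in>\<gamma>. b i j) = stack_moment b s w"
  using assms
proof (induction w arbitrary: s)
  case Nil
  then show ?case by (simp add: open_pairings_no_letters)
next
  case (Cons p w)
  let ?wt = "\<lambda>\<gamma>. \<Prod>(i, j)\<in>\<gamma>. b i j"
  have p: "\<And>t. t \<in> set w \<Longrightarrow> p < t" and "p \<notin> set w" using Cons.prems by auto
  have push: "sum ?wt (open_pairings (insert p (set s)) (set w)) = stack_moment b (p # s) w"
    using Cons.IH[of "p # s"] Cons.prems by auto
  show ?case
  proof (cases s)
    case Nil
    then show ?thesis using push open_pairings_empty_stack[OF p] by simp
  next
    case (Cons i s')
    have i: "\<And>x. x \<in> set s' \<Longrightarrow> x < i" and "i < p"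
      using Cons.prems \<open>s = i # s'\<close> by auto
    have notin: "p \<notin> set s'" using i \<open>i < p\<close> by (auto dest: less_asym)
    let ?D = "open_pairings (set s) (insert p (set w))"
    have fin: "finite ?D" by (simp add: finite_open_pairings)
    have new: "(i, p) \<notin> \<gamma>" if "\<gamma> \<in> open_pairings (set s') (set w)" for \<gamma>
      using open_pairingsD(1)[OF that] \<open>p \<notin> set w\<close> by blast
    have fin_pairing: "finite \<gamma>" if "\<gamma> \<in> open_pairings (set s') (set w)" for \<gamma>
      using finite_open_pairings(2)[OF _ _ that] by simp
    have "sum ?wt ?D = sum ?wt {\<gamma>\<in>?D. p \<notin> snd ` \<gamma>} + sum ?wt {\<gamma>\<in>?D. p \<in> snd ` \<gamma>}"
      using fin by (subst sum.union_disjoint[symmetric]) (auto intro: sum.cong)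
    also have "{\<gamma>\<in>?D. p \<notin> snd ` \<gamma>} = open_pairings (insert p (set s)) (set w)"
      using open_pairings_push[OF \<open>p \<notin> set w\<close>] by simp
    also have "{\<gamma>\<in>?D. p \<in> snd ` \<gamma>} = insert (i, p) ` open_pairings (set s') (set w)"
      using open_pairings_pop[OF i \<open>i < p\<close> p] Cons by simp
    also have "sum ?wt \<dots> = (\<Sum>\<gamma>\<in>open_pairings (set s') (set w). ?wt (insert (i, p) \<gamma>))"
      by (rule sum.reindex_cong[OF _ refl refl]) (use new in \<open>auto intro!: inj_onI dest: insert_ident\<close>)
    also have "\<dots> = (\<Sum>\<gamma>\<in>open_pairings (set s') (set w). b i p * ?wt \<gamma>)"
      by (intro sum.cong refl) (simp add: new fin_pairing)
    also have "\<dots> = b i p * stack_moment b s' w"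
      using Cons.IH[of s'] Cons.prems Cons by (simp add: sum_distrib_left[symmetric])
    finally show ?thesis using push Cons by simp
  qed
qed

lemma sum_NC_diagrams:
  "(\<Sum>\<gamma>\<in>NC_diagrams m. \<Prod>(i, j)\<in>\<gamma>. c (\<sigma> i) (\<sigma> j)) = stack_moment c [] (map \<sigma> [1..<m + 1])"
proof -
  have "set [1..<m + 1] = {1..m}" by auto
  moreover have "sorted_wrt (<) [1..<m + 1]" by (simp del: upt_Suc)
  ultimately show ?thesis
    using sum_open_pairings[of "[]" "[1..<m + 1]" "\<lambda>i j. c (\<sigma> i) (\<sigma> j)"]
      stack_moment_map[of c \<sigma> "[]" "[1..<m + 1]"]
    by (simp add: NC_diagrams_eq_open_pairings del: upt_Suc)
qed

text \<open>
  The even and the odd case of the definition merge, since the stack recursion vanishes on words of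
  odd length; every word \<open>w\<close> arises from the labelling \<open>i \<mapsto> w ! (i - 1)\<close> of its positions.
\<close>

lemma semicircular_family_iff_stack_moment:
  "semicircular_family d c Y \<psi> \<longleftrightarrow> nc_prob_space d Y \<psi> \<and>
     (\<forall>w. set w \<subseteq> {1..d} \<longrightarrow> nc_expect \<psi> (op_word Y w) = stack_moment c [] w)"
    (is "?L \<longleftrightarrow> _ \<and> ?R")
proof -
  have "?L \<longleftrightarrow> nc_prob_space d Y \<psi> \<and> (\<forall>k. \<forall>\<sigma>\<in>{1..k} \<rightarrow> {1..d}.
      nc_expect \<psi> (op_word Y (map \<sigma> [1..<k + 1])) = stack_moment c [] (map \<sigma> [1..<k + 1]))"
  proof -
    have "((\<forall>n. k = 2 * n \<longrightarrow> x = (\<Sum>\<gamma>\<in>NC_diagrams (2 * n). \<Prod>(i, j)\<in>\<gamma>. c (\<sigma> i) (\<sigma> j))) \<and>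
        (odd k \<longrightarrow> x = 0)) \<longleftrightarrow> x = stack_moment c [] (map \<sigma> [1..<k + 1])" for k :: nat and x and \<sigma> :: "nat \<Rightarrow> nat"
      using stack_moment_odd[of "[]" "map \<sigma> [1..<k + 1]" c] sum_NC_diagrams[where m = k and c = c and \<sigma> = \<sigma>]
      by (cases "even k") (auto elim!: evenE simp del: upt_Suc)
    then show ?thesis unfolding semicircular_family_def by (simp only:)
  qed
  also have "(\<forall>k. \<forall>\<sigma>\<in>{1..k} \<rightarrow> {1..d}.
      nc_expect \<psi> (op_word Y (map \<sigma> [1..<k + 1])) = stack_moment c [] (map \<sigma> [1..<k + 1])) \<longleftrightarrow> ?R"
    (is "?M \<longleftrightarrow> ?R")
  proof
    assume M: ?M
    show ?R
    proof (intro allI impI)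
      fix w assume w: "set w \<subseteq> {1..d}"
      let ?\<sigma> = "\<lambda>i. w ! (i - 1)"
      have "map ?\<sigma> [1..<length w + 1] = w"
        by (rule nth_equalityI) (simp_all del: upt_Suc)
      moreover have "?\<sigma> \<in> {1..length w} \<rightarrow> {1..d}"
        by (rule Pi_I, rule subsetD[OF w], rule nth_mem) auto
      ultimately show "nc_expect \<psi> (op_word Y w) = stack_moment c [] w"
        using M by metis
    qed
  next
    assume R: ?R
    show ?M
    proof (intro allI ballI)
      fix k :: nat and \<sigma> assume "\<sigma> \<in> {1..k} \<rightarrow> {1..d}"
      then have "set (map \<sigma> [1..<k + 1]) \<subseteq> {1..d}" by (auto simp: Pi_iff)
      with R show "nc_expect \<psi> (op_word Y (map \<sigma> [1..<k + 1])) = stack_moment c [] (map \<sigma> [1..<k + 1])"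
        by blast
    qed
  qed
  finally show ?thesis .
qed

section \<open>The orbit of the vacuum vector\<close>

text \<open>
  Gram-Schmidt orthogonalisation, one generator at a time, in an inner product space of arbitrary
  dimension. It is needed to split the filtration of the orbit into its grades.
\<close>

lemma orthogonal_decomposition_finite_span:
  fixes x :: "'a::real_inner"
  assumes "finite B"
  obtains y where "y \<in> span B" "\<And>u. u \<in> span B \<Longrightarrow> orthogonal u (x - y)"
proof -
  have "\<exists>y\<in>span B. \<forall>u\<in>span B. inner u (x - y) = 0" for x :: 'a
    using assms
  proof (induction B arbitrary: x)
    case (insert b B)
    obtain b0 where b0: "b0 \<in> span B" "\<forall>u\<in>span B. inner u (b - b0) = 0"
      using insert.IH[of b] by blast
    obtain x0 where x0: "x0 \<in> span B" "\<forall>u\<in>span B. inner u (x - x0) = 0"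
      using insert.IH[of x] by blast
    define e where "e = b - b0"
    \<comment> \<open>Division by zero makes \<open>t = 0\<close> when \<open>b\<close> already lies in the span.\<close>
    define t where "t = inner e x / inner e e"
    have sub: "span B \<subseteq> span (insert b B)" by (rule span_mono) blast
    have e: "e \<in> span (insert b B)"
      unfolding e_def using b0 sub by (blast intro: span_diff span_base)
    have "x0 + t *\<^sub>R e \<in> span (insert b B)"
      using e x0 sub by (blast intro: span_add span_scale)
    moreover have "inner u (x - (x0 + t *\<^sub>R e)) = 0" if u: "u \<in> span (insert b B)" for u
    proof -
      obtain r where r: "u - r *\<^sub>R b \<in> span B" using u by (auto simp: span_insert)
      define v where "v = u - r *\<^sub>R b + r *\<^sub>R b0"
      have v: "v \<in> span B" unfolding v_def using r b0 by (blast intro: span_add span_scale)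
      have "u = v + r *\<^sub>R e" by (simp add: v_def e_def algebra_simps)
      moreover have "inner v (x - x0) = 0" "inner v e = 0" "inner e x0 = 0"
        using v x0 b0 by (auto simp: e_def inner_commute)
      moreover have "t * inner e e = inner e x" by (cases "e = 0") (auto simp: t_def)
      ultimately show ?thesis by (simp add: inner_simps)
    qed
    ultimately show ?case by blast
  qed simp
  then show ?thesis using that by (metis orthogonal_def)
qed

locale vacuum_space =
  fixes d :: nat and X :: "nat \<Rightarrow> ('h::{real_inner, complete_space} \<rightharpoonup> 'h)" and \<phi> :: 'h
  assumes prob_space: "nc_prob_space d X \<phi>"
begin

abbreviation orbit :: "'h set" where "orbit \<equiv> vacuum_orbit d X \<phi>"

abbreviation word_vec :: "nat list \<Rightarrow> 'h" where "word_vec w \<equiv> the (op_word X w \<phi>)"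

lemma X_linear: "i \<in> {1..d} \<Longrightarrow> op_linear (X i)"
  and norm_vacuum: "norm \<phi> = 1"
  and vacuum_in_dom: "g \<in> op_algebra d X \<Longrightarrow> \<phi> \<in> dom g"
  using prob_space by (auto simp: nc_prob_space_def)

text \<open>
  The vacuum lies in the domain of every product \<open>g \<circ>\<^sub>m h\<close>, and this forces \<open>h \<phi>\<close> into the domain of
  \<open>g\<close>. Hence all operators of the algebra act on the orbit as total maps.
\<close>

lemma orbit_in_dom:
  assumes "g \<in> op_algebra d X" "v \<in> orbit"
  shows "v \<in> dom g" "the (g v) \<in> orbit"
proof -
  obtain h where h: "h \<in> op_algebra d X" "v = the (h \<phi>)"
    using assms(2) by (auto simp: vacuum_orbit_def)
  have gh: "g \<circ>\<^sub>m h \<in> op_algebra d X" using assms(1) h(1) by (rule op_algebra.comp)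
  then obtain y where "(g \<circ>\<^sub>m h) \<phi> = Some y" using vacuum_in_dom by blast
  moreover obtain z where "h \<phi> = Some z" using vacuum_in_dom[OF h(1)] by blast
  ultimately have "(g \<circ>\<^sub>m h) \<phi> = g v" "g v = Some y" using h(2) by (auto simp: map_comp_def)
  with gh show "v \<in> dom g" "the (g v) \<in> orbit"
    by (auto simp: vacuum_orbit_def intro!: exI[of _ "g \<circ>\<^sub>m h"])
qed

lemma orbitI: "g \<in> op_algebra d X \<Longrightarrow> the (g \<phi>) \<in> orbit"
  by (auto simp: vacuum_orbit_def)

lemma vacuum_in_orbit: "\<phi> \<in> orbit"
  using orbitI[OF op_algebra.one] by simp

lemma subspace_orbit: "subspace orbit"
proof (rule subspaceI)
  show scale: "r *\<^sub>R v \<in> orbit" if "v \<in> orbit" for r v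
  proof -
    obtain g where g: "g \<in> op_algebra d X" "v = the (g \<phi>)"
      using \<open>v \<in> orbit\<close> by (auto simp: vacuum_orbit_def)
    then have "the (op_scale r g \<phi>) = r *\<^sub>R v"
      using vacuum_in_dom[of g] by (simp add: op_scale_def)
    then show ?thesis using orbitI[OF op_algebra.scale[OF g(1), of r]] by simp
  qed
  show "0 \<in> orbit" using scale[OF vacuum_in_orbit, of 0] by simp
  fix u v assume "u \<in> orbit" "v \<in> orbit"
  then obtain g h where gh: "g \<in> op_algebra d X" "u = the (g \<phi>)"
      "h \<in> op_algebra d X" "v = the (h \<phi>)"
    by (auto simp: vacuum_orbit_def)
  then have "the (op_add g h \<phi>) = u + v"
    using vacuum_in_dom[of g] vacuum_in_dom[of h] by (simp add: op_add_def)
  then show "u + v \<in> orbit" using orbitI[OF op_algebra.add[OF gh(1,3)]] by simp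
qed

lemma op_word_in_algebra: "set w \<subseteq> {1..d} \<Longrightarrow> op_word X w \<in> op_algebra d X"
proof (induction w)
  case (Cons i w)
  then have "X i \<circ>\<^sub>m op_word X w \<in> op_algebra d X"
    by (intro op_algebra.comp op_algebra.gen) auto
  then show ?case by (simp add: op_word_def)
qed (simp add: op_word_def op_algebra.one)

lemma vacuum_in_dom_word: "set w \<subseteq> {1..d} \<Longrightarrow> \<phi> \<in> dom (op_word X w)"
  by (intro vacuum_in_dom op_word_in_algebra)

lemma word_vec_in_orbit: "set w \<subseteq> {1..d} \<Longrightarrow> word_vec w \<in> orbit"
  using op_word_in_algebra by (auto simp: vacuum_orbit_def)

lemma word_vec_Nil: "word_vec [] = \<phi>"
  by (simp add: op_word_def)

lemma word_vec_Cons: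
  "set w \<subseteq> {1..d} \<Longrightarrow> word_vec (i # w) = the (X i (word_vec w))"
  using vacuum_in_dom_word[of w] by (auto simp: op_word_def map_comp_def)

lemma op_poly_vacuum:
  assumes "p \<in> ncpolys d"
  shows "the (op_poly X p \<phi>) = (\<Sum>w\<in>Poly_Mapping.keys p. Poly_Mapping.lookup p w *\<^sub>R word_vec w)"
proof -
  have "\<forall>w\<in>Poly_Mapping.keys p. \<phi> \<in> dom (op_word X w)"
    using assms vacuum_in_dom_word unfolding ncpolys_def by blast
  then show ?thesis by (simp add: op_poly_def)
qed

lemma nc_expect_op_poly:
  assumes "p \<in> ncpolys d"
  shows "nc_expect \<phi> (op_poly X p) =
    (\<Sum>w\<in>Poly_Mapping.keys p. Poly_Mapping.lookup p w * nc_expect \<phi> (op_word X w))"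
  by (simp add: nc_expect_def op_poly_vacuum[OF assms] inner_sum_left)

definition words :: "nat \<Rightarrow> nat list set" where
  "words n = {w. set w \<subseteq> {1..d} \<and> length w \<le> n}"

lemma finite_words: "finite (words n)"
  unfolding words_def by (rule finite_lists_length_le) simp

text \<open>
  Distinct words may give the same vector, so coefficients of a linear combination are indexed by
  words rather than by vectors to obtain a polynomial from them.
\<close>

lemma filt_space_eq_span: "filt_space d X \<phi> n = span (word_vec ` words n)"
proof
  show "filt_space d X \<phi> n \<subseteq> span (word_vec ` words n)"
  proof
    fix v assume "v \<in> filt_space d X \<phi> n"
    then obtain p where p: "v = the (op_poly X p \<phi>)" "p \<in> ncpolys d"
        "\<forall>w\<in>Poly_Mapping.keys p. length w \<le> n"
      by (auto simp: filt_space_def)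
    have "v = (\<Sum>w\<in>Poly_Mapping.keys p. Poly_Mapping.lookup p w *\<^sub>R word_vec w)"
      using p op_poly_vacuum by simp
    also have "\<dots> \<in> span (word_vec ` words n)"
      using p by (intro span_sum span_scale span_base imageI) (auto simp: words_def ncpolys_def)
    finally show "v \<in> span (word_vec ` words n)" .
  qed
  let ?C = "range (\<lambda>u. \<Sum>w\<in>words n. u w *\<^sub>R word_vec w)"
  have "span (word_vec ` words n) \<subseteq> ?C"
  proof (rule span_minimal)
    show "subspace ?C"
    proof (rule subspaceI)
      show "0 \<in> ?C" by (rule range_eqI[of _ _ "\<lambda>_. 0"]) simp
      fix x assume "x \<in> ?C"
      then obtain u where u: "x = (\<Sum>w\<in>words n. u w *\<^sub>R word_vec w)" by blast
      show "r *\<^sub>R x \<in> ?C" for r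
        by (rule range_eqI[of _ _ "\<lambda>w. r * u w"]) (simp add: u scaleR_sum_right)
      fix y assume "y \<in> ?C"
      then obtain u' where u': "y = (\<Sum>w\<in>words n. u' w *\<^sub>R word_vec w)" by blast
      show "x + y \<in> ?C"
        by (rule range_eqI[of _ _ "\<lambda>w. u w + u' w"])
          (simp add: u u' scaleR_left_distrib sum.distrib)
    qed
    show "word_vec ` words n \<subseteq> ?C"
    proof
      fix x assume "x \<in> word_vec ` words n"
      then obtain w where w: "w \<in> words n" "x = word_vec w" by blast
      have "(\<Sum>w'\<in>words n. (if w' = w then 1 else 0) *\<^sub>R word_vec w') = x"
        using w finite_words by (simp add: if_distrib[of "\<lambda>r. r *\<^sub>R _"] cong: if_cong)
      then show "x \<in> ?C" by (intro range_eqI[of _ _ "\<lambda>w'. if w' = w then 1 else 0"]) simp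
    qed
  qed
  also have "?C \<subseteq> filt_space d X \<phi> n"
  proof
    fix x assume "x \<in> ?C"
    then obtain u where u: "x = (\<Sum>w\<in>words n. u w *\<^sub>R word_vec w)" by blast
    define p where "p = Abs_poly_mapping (\<lambda>w. if w \<in> words n then u w else 0)"
    have "finite {w. (if w \<in> words n then u w else 0) \<noteq> 0}"
      by (rule finite_subset[OF _ finite_words[of n]]) auto
    then have look: "Poly_Mapping.lookup p = (\<lambda>w. if w \<in> words n then u w else 0)"
      unfolding p_def by (rule lookup_Abs_poly_mapping)
    have keys: "Poly_Mapping.keys p \<subseteq> words n"
      by (auto simp: keys.rep_eq look split: if_splits)
    then have p: "p \<in> ncpolys d" "\<forall>w\<in>Poly_Mapping.keys p. length w \<le> n"
      by (auto simp: ncpolys_def words_def)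
    have "the (op_poly X p \<phi>) = (\<Sum>w\<in>words n. Poly_Mapping.lookup p w *\<^sub>R word_vec w)"
      unfolding op_poly_vacuum[OF p(1)]
      by (rule sum.mono_neutral_left[OF finite_words keys]) (auto simp: in_keys_iff)
    also have "\<dots> = x" unfolding u look by (auto intro: sum.cong)
    finally show "x \<in> filt_space d X \<phi> n" unfolding filt_space_def using p by blast
  qed
  finally show "span (word_vec ` words n) \<subseteq> filt_space d X \<phi> n" .
qed

lemma span_words_le_orbit: "span (word_vec ` {w. set w \<subseteq> {1..d}}) \<subseteq> orbit"
  using word_vec_in_orbit by (intro span_minimal subspace_orbit) auto

lemma filt_space_le_orbit: "filt_space d X \<phi> n \<subseteq> orbit"
  unfolding filt_space_eq_span
  by (rule order_trans[OF span_mono span_words_le_orbit]) (auto simp: words_def)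

lemma algebra_preserves_span_words:
  assumes "g \<in> op_algebra d X" "v \<in> span (word_vec ` {w. set w \<subseteq> {1..d}})"
  shows "the (g v) \<in> span (word_vec ` {w. set w \<subseteq> {1..d}})" (is "_ \<in> ?U")
  using assms
proof (induction arbitrary: v)
  case one
  then show ?case by simp
next
  case (gen i)
  have lin: "the (X i (r *\<^sub>R x + y)) = r *\<^sub>R the (X i x) + the (X i y)" if "x \<in> orbit" "y \<in> orbit" for r x y
  proof -
    have "x \<in> dom (X i)" "y \<in> dom (X i)" "r *\<^sub>R x \<in> dom (X i)"
      using orbit_in_dom(1)[OF op_algebra.gen[OF gen.hyps]] that subspace_scale[OF subspace_orbit] by blast+
    then show ?thesis using X_linear[OF gen.hyps] unfolding op_linear_def by simp
  qed
  have "v \<in> orbit \<and> the (X i v) \<in> ?U" using gen.prems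
  proof (induction rule: span_induct_alt)
    case base
    show ?case
      using lin[OF vacuum_in_orbit vacuum_in_orbit, of "-1"] subspace_0[OF subspace_orbit]
      by (simp add: span_zero)
  next
    case (step r x y)
    then obtain w where w: "x = word_vec w" "set w \<subseteq> {1..d}" by blast
    then have "the (X i x) = word_vec (i # w)" "set (i # w) \<subseteq> {1..d}"
      using gen.hyps word_vec_Cons by auto
    then have "the (X i x) \<in> ?U" by (metis imageI mem_Collect_eq span_base)
    moreover have "the (X i (r *\<^sub>R x + y)) = r *\<^sub>R the (X i x) + the (X i y)"
      using w word_vec_in_orbit step by (intro lin) auto
    moreover have "r *\<^sub>R x + y \<in> orbit"
      using w word_vec_in_orbit step by (simp add: subspace_add subspace_scale subspace_orbit)
    ultimately show ?case using step by (simp add: span_add span_scale)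
  qed
  then show ?case ..
next
  case (scale T r)
  then show ?case
    using orbit_in_dom(1)[of T v] span_words_le_orbit by (auto simp: op_scale_def intro: span_scale)
next
  case (add S T)
  then show ?case
    using orbit_in_dom(1)[of T v] orbit_in_dom(1)[of S v] span_words_le_orbit
    by (auto simp: op_add_def intro: span_add)
next
  case (comp S T)
  then have "v \<in> dom T" using orbit_in_dom(1) span_words_le_orbit by blast
  then have "(S \<circ>\<^sub>m T) v = S (the (T v))" by (auto simp: map_comp_def)
  then show ?case using comp by simp
qed

text \<open>
  Elements of the algebra are built by arbitrary nesting of sums and products, yet they produce no
  vectors beyond the polynomials in the generators.
\<close>

lemma orbit_le_filt_space:
  assumes "v \<in> orbit"
  shows "\<exists>n. v \<in> filt_space d X \<phi> n"
proof -
  obtain g where "g \<in> op_algebra d X" "v = the (g \<phi>)"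
    using assms by (auto simp: vacuum_orbit_def)
  moreover have "\<phi> \<in> span (word_vec ` {w. set w \<subseteq> {1..d}})"
    using word_vec_Nil by (metis (mono_tags) empty_set empty_subsetI imageI mem_Collect_eq span_base)
  ultimately have "v \<in> span (word_vec ` {w. set w \<subseteq> {1..d}})"
    using algebra_preserves_span_words by blast
  then show ?thesis
  proof (induction rule: span_induct_alt)
    case base
    show ?case unfolding filt_space_eq_span by (blast intro: span_zero)
  next
    case (step r x y)
    then obtain w n where w: "x = word_vec w" "set w \<subseteq> {1..d}" and n: "y \<in> filt_space d X \<phi> n" by blast
    let ?m = "max (length w) n"
    have "x \<in> span (word_vec ` words ?m)" using w by (auto simp: words_def intro: span_base)
    moreover have "y \<in> span (word_vec ` words ?m)"
      by (rule subsetD[OF span_mono n[unfolded filt_space_eq_span]]) (auto simp: words_def)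
    ultimately show ?case unfolding filt_space_eq_span by (blast intro: span_add span_scale)
  qed
qed

lemma filt_space_0: "filt_space d X \<phi> 0 = span {\<phi>}"
proof -
  have "words 0 = {[]}" by (auto simp: words_def)
  then show ?thesis by (simp add: filt_space_eq_span word_vec_Nil)
qed

lemma vacuum_in_filt_space: "\<phi> \<in> filt_space d X \<phi> n"
  unfolding filt_space_eq_span
  by (rule span_base, rule image_eqI[of _ _ "[]"]) (simp_all add: words_def op_word_def)

lemma grade_space_le_orbit: "grade_space d X \<phi> n \<subseteq> orbit"
  using filt_space_le_orbit subspace_0[OF subspace_orbit] by (auto simp: grade_space_def)

lemma grade_space_orthogonal_vacuum:
  assumes "v \<in> grade_space d X \<phi> n" "n \<noteq> 0"
  shows "inner v \<phi> = 0"
  using assms vacuum_in_filt_space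
  by (auto simp: grade_space_def orthogonal_def inner_commute split: if_splits)

text \<open>
  The orbit is spanned by its grades: \<open>F\<^sub>n\<^sub>+\<^sub>1\<close> is the sum of \<open>F\<^sub>n\<close> and the grade \<open>n + 1\<close>, because \<open>F\<^sub>n\<close> has
  finite dimension and so admits an orthogonal projection.
\<close>

lemma functional_vanishes_on_orbit:
  assumes add: "\<And>u v. u \<in> orbit \<Longrightarrow> v \<in> orbit \<Longrightarrow> f (u + v) = f u + (f v :: real)"
    and grade: "\<And>n v. v \<in> grade_space d X \<phi> (int n) \<Longrightarrow> f v = 0"
    and "v \<in> orbit"
  shows "f v = 0"
proof -
  have "f v = 0" if "v \<in> filt_space d X \<phi> n" for n v
    using that
  proof (induction n arbitrary: v)
    case 0
    then show ?case using grade[of v 0] by (simp add: grade_space_def)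
  next
    case (Suc n)
    obtain y where y: "y \<in> filt_space d X \<phi> n" "\<And>u. u \<in> filt_space d X \<phi> n \<Longrightarrow> orthogonal u (v - y)"
      using orthogonal_decomposition_finite_span[of "word_vec ` words n" v] finite_words
      unfolding filt_space_eq_span by blast
    have "span (word_vec ` words n) \<subseteq> span (word_vec ` words (Suc n))"
      by (intro span_mono image_mono) (auto simp: words_def)
    then have "v - y \<in> filt_space d X \<phi> (Suc n)"
      using Suc.prems y(1) unfolding filt_space_eq_span by (blast intro: span_diff)
    then have "v - y \<in> grade_space d X \<phi> (int (Suc n))"
      using y(2) by (simp add: grade_space_def nat_add_distrib)
    then have "f (v - y) = 0" "v - y \<in> orbit" using grade grade_space_le_orbit by blast+
    moreover have "f y = 0" "y \<in> orbit" using Suc.IH y(1) filt_space_le_orbit by blast+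
    ultimately show ?case using add[of "v - y" y] by simp
  qed
  then show ?thesis using orbit_le_filt_space[OF \<open>v \<in> orbit\<close>] by blast
qed

end

section \<open>Moments of operators satisfying free commutation relations\<close>

locale free_fock_space = vacuum_space d X \<phi>
  for d :: nat and X :: "nat \<Rightarrow> ('h::{real_inner, complete_space} \<rightharpoonup> 'h)" and \<phi> :: 'h +
  fixes c :: "nat \<Rightarrow> nat \<Rightarrow> real" and am a0 ap :: "nat \<Rightarrow> ('h \<rightharpoonup> 'h)"
  assumes cap: "\<And>i. i \<in> {1..d} \<Longrightarrow> cap_operators d X \<phi> i (am i) (a0 i) (ap i)"
    and am_ap: "\<And>i j v. i \<in> {1..d} \<Longrightarrow> j \<in> {1..d} \<Longrightarrow> v \<in> vacuum_orbit d X \<phi> \<Longrightarrow>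
           (am i \<circ>\<^sub>m ap j) v = op_scale (c i j) Some v"
    and am_a0: "\<And>i j v. i \<in> {1..d} \<Longrightarrow> j \<in> {1..d} \<Longrightarrow> v \<in> vacuum_orbit d X \<phi> \<Longrightarrow>
           (am i \<circ>\<^sub>m a0 j) v = Some 0"
    and centred: "\<And>i. i \<in> {1..d} \<Longrightarrow> nc_expect \<phi> (X i) = 0"
begin

lemma parts_linear:
  assumes "i \<in> {1..d}" "a \<in> {am i, a0 i, ap i}"
  shows "dom a = orbit"
    and "u \<in> orbit \<Longrightarrow> v \<in> orbit \<Longrightarrow> the (a (u + v)) = the (a u) + the (a v)"
    and "v \<in> orbit \<Longrightarrow> the (a (r *\<^sub>R v)) = r *\<^sub>R the (a v)"
proof -
  have "op_linear a" "dom a = orbit" using cap[OF assms(1)] assms(2) by (auto simp: cap_operators_def)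
  then show "dom a = orbit"
    "u \<in> orbit \<Longrightarrow> v \<in> orbit \<Longrightarrow> the (a (u + v)) = the (a u) + the (a v)"
    "v \<in> orbit \<Longrightarrow> the (a (r *\<^sub>R v)) = r *\<^sub>R the (a v)"
    by (auto simp: op_linear_def)
qed

lemma parts_grade:
  assumes "i \<in> {1..d}" "v \<in> grade_space d X \<phi> (int n)"
  shows "the (am i v) \<in> grade_space d X \<phi> (int n - 1)"
    and "the (a0 i v) \<in> grade_space d X \<phi> (int n)"
    and "the (ap i v) \<in> grade_space d X \<phi> (int n + 1)"
  using cap[OF assms(1)] assms(2) by (auto simp: cap_operators_def)

lemma X_decomposition:
  assumes "i \<in> {1..d}" "v \<in> orbit"
  shows "the (X i v) = the (am i v) + the (a0 i v) + the (ap i v)"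
proof -
  have "v \<in> dom (am i)" "v \<in> dom (a0 i)" "v \<in> dom (ap i)"
    using parts_linear(1)[OF assms(1)] assms(2) by auto
  moreover have "X i v = op_add (op_add (am i) (a0 i)) (ap i) v"
    using cap[OF assms(1)] assms(2) by (auto simp: cap_operators_def)
  moreover have "v \<in> dom (op_add (am i) (a0 i))" using calculation by (simp add: op_add_def dom_def)
  ultimately show ?thesis by (simp add: op_add_def)
qed

lemma X_orbit: "i \<in> {1..d} \<Longrightarrow> v \<in> orbit \<Longrightarrow> the (X i v) \<in> orbit"
  by (intro orbit_in_dom op_algebra.gen)

lemma annihilate_preserved:
  assumes "i \<in> {1..d}" "j \<in> {1..d}" "v \<in> orbit"
  shows "the (a0 j v) \<in> orbit" "the (am i (the (a0 j v))) = 0"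
proof -
  obtain y where y: "a0 j v = Some y" using parts_linear(1)[OF assms(2), of "a0 j"] assms(3) by blast
  then have "am i y = Some 0" using am_a0[OF assms] by (simp add: map_comp_def)
  then show "the (a0 j v) \<in> orbit" "the (am i (the (a0 j v))) = 0"
    using y parts_linear(1)[OF assms(1), of "am i"] by auto
qed

lemma annihilate_created:
  assumes "i \<in> {1..d}" "j \<in> {1..d}" "v \<in> orbit"
  shows "the (ap j v) \<in> orbit" "the (am i (the (ap j v))) = c i j *\<^sub>R v"
proof -
  obtain y where y: "ap j v = Some y" using parts_linear(1)[OF assms(2), of "ap j"] assms(3) by blast
  then have "am i y = Some (c i j *\<^sub>R v)" using am_ap[OF assms] by (simp add: map_comp_def op_scale_def)
  then show "the (ap j v) \<in> orbit" "the (am i (the (ap j v))) = c i j *\<^sub>R v"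
    using y parts_linear(1)[OF assms(1), of "am i"] by auto
qed

text \<open>
  The two commutation relations already put \<open>a\<^sup>0\<close> and \<open>a\<^sup>+\<close> of an orbit vector into the domain of an
  annihilator, which is the orbit; for \<open>a\<^sup>-\<close> the decomposition of \<open>X\<close> then leaves no choice.
\<close>

lemma am_orbit:
  assumes "i \<in> {1..d}" "v \<in> orbit"
  shows "the (am i v) \<in> orbit"
proof -
  have "the (am i v) = the (X i v) - the (a0 i v) - the (ap i v)"
    using X_decomposition[OF assms] by simp
  then show ?thesis
    using X_orbit[OF assms] annihilate_preserved(1)[OF assms(1,1,2)] annihilate_created(1)[OF assms(1,1,2)]
    by (simp add: subspace_diff subspace_orbit)
qed

lemma vacuum_in_grade_0: "\<phi> \<in> grade_space d X \<phi> (int 0)"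
  using vacuum_in_filt_space by (simp add: grade_space_def)

lemma am_vacuum: "i \<in> {1..d} \<Longrightarrow> the (am i \<phi>) = 0"
  using parts_grade(1)[OF _ vacuum_in_grade_0] by (simp add: grade_space_def)

lemma inner_created_vacuum:
  assumes "i \<in> {1..d}" "v \<in> orbit"
  shows "inner (the (ap i v)) \<phi> = 0"
proof (rule functional_vanishes_on_orbit[where f = "\<lambda>v. inner (the (ap i v)) \<phi>"])
  show "inner (the (ap i v)) \<phi> = 0" if "v \<in> grade_space d X \<phi> (int n)" for n v
    using parts_grade(3)[OF assms(1) that] by (rule grade_space_orthogonal_vacuum) simp
qed (use assms parts_linear(2)[OF assms(1), of "ap i"] in \<open>auto simp: inner_add_left\<close>)

text \<open>
  Only the degree 0 part, a multiple of the vacuum, can contribute. There \<open>\<langle>a\<^sup>0(i) \<phi>, \<phi>\<rangle>\<close> is the mean of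
  \<open>X\<^sub>i\<close>, since the annihilated and the created part of \<open>X\<^sub>i \<phi>\<close> do not contribute to it, and this mean is 0.
\<close>

lemma inner_preserved_vacuum:
  assumes "i \<in> {1..d}" "v \<in> orbit"
  shows "inner (the (a0 i v)) \<phi> = 0"
proof (rule functional_vanishes_on_orbit[where f = "\<lambda>v. inner (the (a0 i v)) \<phi>"])
  have *: "inner (the (a0 i \<phi>)) \<phi> = 0"
    using X_decomposition[OF assms(1) vacuum_in_orbit] centred[OF assms(1)] am_vacuum[OF assms(1)]
      inner_created_vacuum[OF assms(1) vacuum_in_orbit]
    by (simp add: nc_expect_def inner_add_left)
  show "inner (the (a0 i v)) \<phi> = 0" if v: "v \<in> grade_space d X \<phi> (int n)" for n v
  proof (cases "n = 0")
    case True
    then have "v \<in> span {\<phi>}" using v by (simp add: grade_space_def filt_space_0)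
    then obtain r where "v = r *\<^sub>R \<phi>" by (auto simp: span_singleton)
    then show ?thesis using * parts_linear(3)[OF assms(1), of "a0 i"] vacuum_in_orbit by simp
  next
    case False
    then show ?thesis
      using grade_space_orthogonal_vacuum[OF parts_grade(2)[OF assms(1) v]] by simp
  qed
qed (use assms parts_linear(2)[OF assms(1), of "a0 i"] in \<open>auto simp: inner_add_left\<close>)

text \<open>
  The head of the list is the top of the stack, the annihilator next to the unread letters.
\<close>

definition annihilate :: "nat list \<Rightarrow> 'h \<Rightarrow> 'h" where
  "annihilate s v = fold (\<lambda>i v. the (am i v)) s v"

lemma annihilate_linear:
  assumes "set s \<subseteq> {1..d}" "u \<in> orbit" "v \<in> orbit"
  shows "annihilate s (u + r *\<^sub>R v) = annihilate s u + r *\<^sub>R annihilate s v"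
  using assms
proof (induction s arbitrary: u v)
  case (Cons i s)
  then have i: "i \<in> {1..d}" by simp
  have "the (am i (u + r *\<^sub>R v)) = the (am i u) + r *\<^sub>R the (am i v)"
    using Cons.prems parts_linear(2,3)[OF i, of "am i"] subspace_scale[OF subspace_orbit] by simp
  then show ?case using Cons am_orbit[OF i] by (simp add: annihilate_def)
qed (simp add: annihilate_def)

lemma annihilate_zero: "set s \<subseteq> {1..d} \<Longrightarrow> annihilate s 0 = 0"
  using annihilate_linear[of s \<phi> \<phi> "-1"] vacuum_in_orbit by simp

text \<open>
  The top annihilator \<open>a\<^sup>-(i)\<close> meets the letter \<open>X\<^sub>j\<close>: the summand \<open>a\<^sup>-(j)\<close> becomes the new top, \<open>a\<^sup>0(j)\<close> is
  killed, and \<open>a\<^sup>+(j)\<close> cancels the top and leaves \<open>c i j\<close>. This is the recursion of \<open>stack_moment\<close>.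
\<close>

lemma inner_annihilate_word:
  assumes "set s \<subseteq> {1..d}" "set w \<subseteq> {1..d}"
  shows "inner (annihilate s (word_vec w)) \<phi> = stack_moment c s w"
  using assms
proof (induction w arbitrary: s)
  case Nil
  show ?case
  proof (cases s)
    case Nil
    then show ?thesis using norm_vacuum by (simp add: word_vec_Nil annihilate_def norm_eq_1)
  next
    case (Cons i s')
    then have "annihilate s (word_vec []) = annihilate s' 0"
      using Nil am_vacuum[of i] unfolding word_vec_Nil by (simp add: annihilate_def)
    then show ?thesis using annihilate_zero[of s'] Nil Cons by simp
  qed
next
  case (Cons j w)
  then have j: "j \<in> {1..d}" and w: "set w \<subseteq> {1..d}" by auto
  define v where "v = word_vec w"
  have v: "v \<in> orbit" and Xv: "word_vec (j # w) = the (X j v)"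
    using word_vec_in_orbit[OF w] word_vec_Cons[OF w] by (auto simp: v_def)
  have push: "inner (annihilate (j # s) v) \<phi> = stack_moment c (j # s) w"
    using Cons.IH[of "j # s"] Cons.prems by (simp add: v_def)
  show ?case
  proof (cases s)
    case Nil
    then show ?thesis
      using push X_decomposition[OF j v] inner_created_vacuum[OF j v] inner_preserved_vacuum[OF j v]
      by (simp add: Xv annihilate_def inner_add_left)
  next
    case (Cons i s')
    then have i: "i \<in> {1..d}" and s': "set s' \<subseteq> {1..d}" using Cons.prems by auto
    have orb: "the (am j v) \<in> orbit" "the (a0 j v) \<in> orbit" "the (ap j v) \<in> orbit"
      using am_orbit[OF j v] annihilate_preserved(1)[OF i j v] annihilate_created(1)[OF i j v] .
    have "the (am i (the (X j v))) = the (am i (the (am j v))) + c i j *\<^sub>R v"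
      using parts_linear(2)[OF i, of "am i"] orb subspace_add[OF subspace_orbit]
        annihilate_preserved(2)[OF i j v] annihilate_created(2)[OF i j v]
      by (simp add: X_decomposition[OF j v])
    then have "annihilate s (the (X j v)) =
        annihilate s' (the (am i (the (am j v))) + c i j *\<^sub>R v)"
      by (simp add: Cons annihilate_def)
    also have "\<dots> = annihilate s' (the (am i (the (am j v)))) + c i j *\<^sub>R annihilate s' v"
      using annihilate_linear[OF s'] am_orbit[OF i orb(1)] v by blast
    also have "annihilate s' (the (am i (the (am j v)))) = annihilate (j # s) v"
      by (simp add: Cons annihilate_def)
    finally show ?thesis
      using push Cons.IH[OF s' w] by (simp add: Xv Cons inner_add_left v_def)
  qed
qed

lemma semicircular: "semicircular_family d c X \<phi>"
  using prob_space inner_annihilate_word[of "[]"]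
  by (auto simp: semicircular_family_iff_stack_moment nc_expect_def annihilate_def)

end

lemma semicircular_family_moment_equal:
  assumes "semicircular_family d c X \<phi>" "semicircular_family d c Y \<psi>"
  shows "moment_equal d X \<phi> Y \<psi>"
proof -
  interpret X: vacuum_space d X \<phi> using assms(1) by unfold_locales (simp add: semicircular_family_def)
  interpret Y: vacuum_space d Y \<psi> using assms(2) by unfold_locales (simp add: semicircular_family_def)
  have "nc_expect \<phi> (op_word X w) = nc_expect \<psi> (op_word Y w)"
    if "p \<in> ncpolys d" "w \<in> Poly_Mapping.keys p" for p w
    using assms that by (simp add: semicircular_family_iff_stack_moment ncpolys_def)
  then show ?thesis
    unfolding moment_equal_def by (simp add: X.nc_expect_op_poly Y.nc_expect_op_poly)
qed

theorem corollary4p9: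
  fixes d :: nat
    and c :: "nat \<Rightarrow> nat \<Rightarrow> real"
    and X am a0 ap :: "nat \<Rightarrow> ('h::{real_inner, complete_space} \<rightharpoonup> 'h)"
    and \<phi> :: 'h
  assumes "d \<ge> 1"
    and "nc_prob_space d X \<phi>"
    and "\<And>i. i \<in> {1..d} \<Longrightarrow> cap_operators d X \<phi> i (am i) (a0 i) (ap i)"
    and "\<And>i j v. i \<in> {1..d} \<Longrightarrow> j \<in> {1..d} \<Longrightarrow> v \<in> vacuum_orbit d X \<phi> \<Longrightarrow>
           (am i \<circ>\<^sub>m ap j) v = op_scale (c i j) Some v"
    and "\<And>i j v. i \<in> {1..d} \<Longrightarrow> j \<in> {1..d} \<Longrightarrow> v \<in> vacuum_orbit d X \<phi> \<Longrightarrow>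
           (am i \<circ>\<^sub>m a0 j) v = Some 0"
    and "\<And>i. i \<in> {1..d} \<Longrightarrow> nc_expect \<phi> (X i) = 0"
  shows "(\<exists>(Y :: nat \<Rightarrow> ('h \<rightharpoonup> 'h)) \<psi>.
            semicircular_family d c Y \<psi> \<and> moment_equal d X \<phi> Y \<psi>) \<and>
         (\<forall>(Y :: nat \<Rightarrow> ('k::{real_inner, complete_space} \<rightharpoonup> 'k)) \<psi>.
            semicircular_family d c Y \<psi> \<longrightarrow> moment_equal d X \<phi> Y \<psi>)"
proof -
  interpret free_fock_space d X \<phi> c am a0 ap
    using assms by unfold_locales
  show ?thesis
    using semicircular semicircular_family_moment_equal[OF semicircular semicircular]
      semicircular_family_moment_equal[OF semicircular] by blast
qed

end
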